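(* Let $\theta$ be a cardinal and $(\mathcal R,\mu)=(\mathcal R_{(\theta)},\mu_{(\theta)})$. Let $\delta\ge 0$ be real. If $\mathcal A$ is an uncountable family of pairs $(x,s)$ with $x\in\mathcal R$, $s\in\mathrm{Fin}(\theta,\{0,1\})$ and $\mu(x\mid[s])>\delta$ for all $(x,s)\in\mathcal A$, then there is an uncountable $\mathcal B\subseteq\mathcal A$ such that $[s]\wedge[t]\ne 0$ and $\mu(x\wedge y\mid[s]\wedge[t])>\delta^2$ for all $(x,s),(y,t)\in\mathcal B$.
   Context: $(\mathcal R_{(\theta)},\mu_{(\theta)})$ is the measure algebra of $\{0,1\}^\theta$ with its Haar (product) probability measure. $\mathrm{Fin}(\theta,\{0,1\})$ is the set of finite partial functions from $\theta$ to $\{0,1\}$, and $[s]$ is the class of $\{z\in\{0,1\}^\theta: z\supseteq s\}$. Conditional probability: $\mu(x\mid y)=\mu(x\wedge y)/\mu(y)$ for $y\ne0$. *)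

theory Defs
  imports "HOL-Probability.Probability"
begin

section \<open>The measure algebra of a measure space\<close>

definition null_equiv :: "'a measure \<Rightarrow> ('a set \<times> 'a set) set" where
  "null_equiv M = {(A, B). A \<in> sets M \<and> B \<in> sets M \<and> sym_diff A B \<in> null_sets M}"

definition malg :: "'a measure \<Rightarrow> 'a set set set" where
  "malg M = sets M // null_equiv M"

definition malg_class :: "'a measure \<Rightarrow> 'a set \<Rightarrow> 'a set set" where
  "malg_class M A = null_equiv M `` {A}"

definition malg_zero :: "'a measure \<Rightarrow> 'a set set" where
  "malg_zero M = malg_class M {}"

text \<open>Meet and measure are defined through arbitrary representatives;
  see \<open>malg_inf_class\<close> and \<open>malg_measure_class\<close> below for independence of the choice.\<close>

definition malg_inf :: "'a measure \<Rightarrow> 'a set set \<Rightarrow> 'a set set \<Rightarrow> 'a set set" where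
  "malg_inf M x y = (\<Union>A\<in>x. \<Union>B\<in>y. malg_class M (A \<inter> B))"

definition malg_measure :: "'a measure \<Rightarrow> 'a set set \<Rightarrow> real" where
  "malg_measure M x = measure M (SOME A. A \<in> x)"

definition malg_cond :: "'a measure \<Rightarrow> 'a set set \<Rightarrow> 'a set set \<Rightarrow> real" where
  "malg_cond M x y = malg_measure M (malg_inf M x y) / malg_measure M y"

lemma equiv_null_equiv: "equiv (sets M) (null_equiv M)"
proof (rule equivI)
  show "null_equiv M \<subseteq> sets M \<times> sets M"
    by (auto simp: null_equiv_def)
  show "refl_on (sets M) (null_equiv M)"
    by (auto simp: refl_on_def null_equiv_def)
  show "sym (null_equiv M)"
    by (auto simp: sym_def null_equiv_def Un_commute)
  show "trans (null_equiv M)"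
  proof (rule transI)
    fix A B C assume *: "(A, B) \<in> null_equiv M" "(B, C) \<in> null_equiv M"
    then have m: "A \<in> sets M" "C \<in> sets M"
      and n: "sym_diff A B \<union> sym_diff B C \<in> null_sets M"
      unfolding null_equiv_def by (simp_all add: null_sets.Un)
    have "sym_diff A C \<in> null_sets M"
      by (rule null_sets_subset[OF n]) (use m in \<open>simp add: sets.Un sets.Diff\<close>, blast)
    with m show "(A, C) \<in> null_equiv M"
      by (simp add: null_equiv_def)
  qed
qed

lemma malg_class_in_malg: "A \<in> sets M \<Longrightarrow> malg_class M A \<in> malg M"
  by (simp add: malg_def malg_class_def quotientI)

lemma malg_class_eq_iff:
  assumes "A \<in> sets M" "B \<in> sets M"
  shows "malg_class M A = malg_class M B \<longleftrightarrow> sym_diff A B \<in> null_sets M"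
  using eq_equiv_class_iff[OF equiv_null_equiv assms] assms
  by (simp add: malg_class_def null_equiv_def)

lemma malg_inf_class:
  assumes "A \<in> sets M" "B \<in> sets M"
  shows "malg_inf M (malg_class M A) (malg_class M B) = malg_class M (A \<inter> B)"
proof -
  have eq: "malg_class M (A' \<inter> B') = malg_class M (A \<inter> B)"
    if "A' \<in> malg_class M A" "B' \<in> malg_class M B" for A' B'
  proof -
    have m: "A' \<in> sets M" "B' \<in> sets M"
      and n: "sym_diff A A' \<union> sym_diff B B' \<in> null_sets M"
      using that by (simp_all add: malg_class_def null_equiv_def null_sets.Un)
    have "sym_diff (A' \<inter> B') (A \<inter> B) \<in> null_sets M"
      by (rule null_sets_subset[OF n])
        (use m assms in \<open>simp add: sets.Un sets.Diff sets.Int\<close>, blast)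
    then show ?thesis
      using m assms by (simp add: malg_class_eq_iff sets.Int)
  qed
  have mem: "A \<in> malg_class M A" "B \<in> malg_class M B"
    using assms by (simp_all add: malg_class_def null_equiv_def)
  show ?thesis
  proof (rule equalityI)
    show "malg_inf M (malg_class M A) (malg_class M B) \<subseteq> malg_class M (A \<inter> B)"
      unfolding malg_inf_def by (intro UN_least) (simp only: eq subset_refl)
    show "malg_class M (A \<inter> B) \<subseteq> malg_inf M (malg_class M A) (malg_class M B)"
      unfolding malg_inf_def using mem by blast
  qed
qed

lemma malg_measure_class:
  assumes "A \<in> sets M"
  shows "malg_measure M (malg_class M A) = measure M A"
proof -
  have "A \<in> malg_class M A"
    using assms by (auto simp: malg_class_def null_equiv_def)
  then have "(SOME A'. A' \<in> malg_class M A) \<in> malg_class M A" by (rule someI)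
  then obtain B where B: "B = (SOME A'. A' \<in> malg_class M A)" "B \<in> sets M"
    "sym_diff A B \<in> null_sets M"
    by (auto simp: malg_class_def null_equiv_def)
  have "AE w in M. w \<in> A \<longleftrightarrow> w \<in> B"
    by (rule AE_I'[OF B(3)]) auto
  then have "measure M A = measure M B"
    by (rule measure_eq_AE[OF _ assms B(2)])
  then show ?thesis by (simp add: malg_measure_def B(1))
qed


section \<open>The measure algebra of \<open>{0,1}\<^sup>\<theta>\<close>\<close>

text \<open>The cardinal \<open>\<theta>\<close> is rendered as an arbitrary index set (possibly finite or empty), and
  \<open>{0,1}\<close> as \<^typ>\<open>bool\<close>. The underlying measure is the product of the uniform
  probability measures on \<^typ>\<open>bool\<close>, on the product sigma-algebra.\<close>

definition cantor_measure :: "'i set \<Rightarrow> ('i \<Rightarrow> bool) measure" where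
  "cantor_measure \<theta> = PiM \<theta> (\<lambda>_. uniform_count_measure UNIV)"

definition Fin_maps :: "'i set \<Rightarrow> ('i \<rightharpoonup> bool) set" where
  "Fin_maps \<theta> = {s. finite (dom s) \<and> dom s \<subseteq> \<theta>}"

definition cylinder :: "'i set \<Rightarrow> ('i \<rightharpoonup> bool) \<Rightarrow> ('i \<Rightarrow> bool) set" where
  "cylinder \<theta> s = {z \<in> space (cantor_measure \<theta>). \<forall>i\<in>dom s. s i = Some (z i)}"

definition cyl_class :: "'i set \<Rightarrow> ('i \<rightharpoonup> bool) \<Rightarrow> ('i \<Rightarrow> bool) set set" where
  "cyl_class \<theta> s = malg_class (cantor_measure \<theta>) (cylinder \<theta> s)"

lemma cylinder_in_sets:
  assumes "s \<in> Fin_maps \<theta>"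
  shows "cylinder \<theta> s \<in> sets (cantor_measure \<theta>)"
proof -
  let ?M = "cantor_measure \<theta>"
  have *: "{z \<in> space ?M. s i = Some (z i)} \<in> sets ?M" if "i \<in> dom s" for i
  proof -
    have "i \<in> \<theta>" using that assms by (auto simp: Fin_maps_def)
    then have "(\<lambda>z. z i) \<in> measurable ?M (uniform_count_measure UNIV)"
      unfolding cantor_measure_def by (rule measurable_component_singleton)
    then have "(\<lambda>z. z i) -` {b. s i = Some b} \<inter> space ?M \<in> sets ?M"
      by (rule measurable_sets) (simp add: sets_uniform_count_measure)
    moreover have "(\<lambda>z. z i) -` {b. s i = Some b} \<inter> space ?M = {z \<in> space ?M. s i = Some (z i)}"
      by auto
    ultimately show ?thesis by simp
  qed
  have "finite (dom s)" using assms by (simp add: Fin_maps_def)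
  then show ?thesis
    unfolding cylinder_def using * by (simp add: sets.sets_Collect_finite_All)
qed

end

theory Submission
  imports Defs
begin

text \<open>Approximate \<open>x \<and> [s]\<close> by a clopen set \<open>c \<le> [s]\<close> that depends on finitely many coordinates \<open>F\<close>,
  with an error small compared with \<open>4\<^sup>-\<^sup>|\<^sup>s\<^sup>|\<close>. Thin out so that \<open>|s|\<close> and \<open>|F|\<close> are constant and the sets
  \<open>F\<close> form a \<open>\<Delta>\<close>-system with root \<open>R\<close>. Only countably many values are possible for \<open>s\<close> restricted
  to \<open>R\<close> together with the function \<open>r \<mapsto> \<mu>(c | [r])\<close> on \<open>{0,1}\<^sup>R\<close>, so thin out again to make
  both constant. Two of the sets \<open>c\<close> are then independent conditionally on the coordinates in \<open>R\<close>, with the same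
  conditional measures, so by Cauchy-Schwarz the average of the squares is at least the square of
  the average, which exceeds \<open>\<delta>\<^sup>2\<close>.\<close>

section \<open>Thinning out uncountable families; Delta-systems\<close>

lemma uncountable_fibre:
  assumes "uncountable A" and "countable (f ` A)"
  obtains c where "uncountable {a\<in>A. f a = c}"
proof -
  have "A = (\<Union>c\<in>f ` A. {a\<in>A. f a = c})" by auto
  then have "\<exists>c\<in>f ` A. uncountable {a\<in>A. f a = c}"
    using assms by (metis (no_types, lifting) countable_UN)
  then show thesis using that by blast
qed

text \<open>Induction on the common size. If some point lies in uncountably many of the sets, it is
  removed from them, the induction hypothesis applies, and the point is put back into the root.
  Otherwise every point lies in only countably many of the sets, and a maximal pairwise disjoint
  subfamily is uncountable, with empty root. The family is indexed, so the same set may occur for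
  many indices.\<close>

lemma delta_system:
  fixes F :: "'a \<Rightarrow> 'b set"
  assumes "uncountable A" and "\<And>a. a \<in> A \<Longrightarrow> finite (F a) \<and> card (F a) = m"
  shows "\<exists>B R. B \<subseteq> A \<and> uncountable B \<and> pairwise (\<lambda>a b. F a \<inter> F b = R) B"
  using assms
proof (induction m arbitrary: A F)
  case 0
  have "F a = {}" if "a \<in> A" for a using "0.prems"(2)[OF that] by auto
  then have "pairwise (\<lambda>a b. F a \<inter> F b = {}) A"
    by (simp add: pairwise_def)
  with "0.prems"(1) show ?case by (intro exI[of _ A] exI[of _ "{}"]) simp
next
  case (Suc m)
  show ?case
  proof (cases "\<exists>p. uncountable {a\<in>A. p \<in> F a}")
    case True
    then obtain p where p: "uncountable {a\<in>A. p \<in> F a}" by blast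
    have "\<exists>B R. B \<subseteq> {a\<in>A. p \<in> F a} \<and> uncountable B \<and>
      pairwise (\<lambda>a b. (F a - {p}) \<inter> (F b - {p}) = R) B"
      by (rule Suc.IH[OF p]) (use Suc.prems(2) in auto)
    then obtain B R where B: "B \<subseteq> {a\<in>A. p \<in> F a}" "uncountable B"
      "pairwise (\<lambda>a b. (F a - {p}) \<inter> (F b - {p}) = R) B" by blast
    have "pairwise (\<lambda>a b. F a \<inter> F b = insert p R) B"
      using B(1,3) unfolding pairwise_def by blast
    with B show ?thesis by blast
  next
    case False
    let ?D = "{B. B \<subseteq> A \<and> pairwise (\<lambda>a b. F a \<inter> F b = {}) B}"
    have "\<exists>B\<in>?D. \<forall>X\<in>?D. B \<subseteq> X \<longrightarrow> X = B"
    proof (rule subset_Zorn')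
      fix C assume "subset.chain ?D C"
      then have C: "C \<subseteq> ?D" "\<And>X Y. X \<in> C \<Longrightarrow> Y \<in> C \<Longrightarrow> X \<subseteq> Y \<or> Y \<subseteq> X"
        by (auto simp: subset_chain_def)
      have "F a \<inter> F b = {}" if h: "X \<in> C" "a \<in> X" "Y \<in> C" "b \<in> Y" "a \<noteq> b" for X Y a b
      proof -
        obtain Z where Z: "Z \<in> C" "a \<in> Z" "b \<in> Z" using C(2)[OF h(1,3)] h by blast
        then have "pairwise (\<lambda>a b. F a \<inter> F b = {}) Z" using C(1) by blast
        then show ?thesis using Z(2,3) h(5) by (rule pairwiseD)
      qed
      then show "\<Union>C \<in> ?D" using C(1) by (auto simp: pairwise_def)
    qed
    then obtain B where "B \<in> ?D" and max: "\<forall>X\<in>?D. B \<subseteq> X \<longrightarrow> X = B" by (rule bexE)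
    then have B: "B \<subseteq> A" "pairwise (\<lambda>a b. F a \<inter> F b = {}) B" by simp_all
    have "uncountable B"
    proof
      assume cB: "countable B"
      \<comment> \<open>By maximality every index outside \<open>B\<close> has a set that meets some
        \<open>F b\<close> with \<open>b\<close> in \<open>B\<close>. For countable \<open>B\<close>
        these sets contain only countably many points, and each point accounts for countably many
        indices.\<close>
      have "A \<subseteq> B \<union> (\<Union>p\<in>(\<Union>b\<in>B. F b). {a\<in>A. p \<in> F a})"
      proof
        fix a assume a: "a \<in> A"
        show "a \<in> B \<union> (\<Union>p\<in>(\<Union>b\<in>B. F b). {a\<in>A. p \<in> F a})"
        proof (rule ccontr)
          assume n: "a \<notin> B \<union> (\<Union>p\<in>(\<Union>b\<in>B. F b). {a\<in>A. p \<in> F a})"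
          then have "pairwise (\<lambda>a b. F a \<inter> F b = {}) (insert a B)"
            using a B by (simp add: pairwise_insert disjoint_iff) blast
          then have "insert a B \<in> ?D" using a B(1) by simp
          with max have "insert a B = B" by blast
          then show False using n by blast
        qed
      qed
      moreover have "countable (F b)" if "b \<in> B" for b
        using that B(1) Suc.prems(2) by (auto intro: countable_finite)
      then have "countable (B \<union> (\<Union>p\<in>(\<Union>b\<in>B. F b). {a\<in>A. p \<in> F a}))"
        using cB False by (intro countable_Un countable_UN) auto
      ultimately have "countable A"
        by (rule countable_subset)
      then show False using Suc.prems(1) by blast
    qed
    with B show ?thesis by blast
  qed
qed

section \<open>Cylinders: measure and intersection\<close>

lemma prob_space_cantor_measure: "prob_space (cantor_measure \<theta>)"
  unfolding cantor_measure_def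
  by (intro prob_space_PiM prob_space_uniform_count_measure) auto

lemma space_cantor_measure: "space (cantor_measure \<theta>) = PiE \<theta> (\<lambda>_. UNIV)"
  by (simp add: cantor_measure_def space_PiM space_uniform_count_measure)

text \<open>The cylinder is the preimage of a finite box with singleton sides, and each side has
  measure one half.\<close>

lemma measure_cylinder:
  assumes "s \<in> Fin_maps \<theta>"
  shows "measure (cantor_measure \<theta>) (cylinder \<theta> s) = 1 / 2 ^ card (dom s)"
proof -
  let ?U = "\<lambda>_. uniform_count_measure (UNIV :: bool set)"
  interpret product_prob_space ?U \<theta>
    by (intro product_prob_spaceI prob_space_uniform_count_measure) auto
  have s: "finite (dom s)" "dom s \<subseteq> \<theta>" using assms by (auto simp: Fin_maps_def)
  have "(\<forall>i\<in>dom s. s i = Some (z i)) \<longleftrightarrow> (\<forall>i\<in>dom s. z i = the (s i))" for z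
    by (rule ball_cong) auto
  then have "z \<in> cylinder \<theta> s \<longleftrightarrow> z \<in> prod_emb \<theta> ?U (dom s) (PiE (dom s) (\<lambda>i. {the (s i)}))" for z
    by (simp only: cylinder_def space_cantor_measure mem_Collect_eq prod_emb_def
        space_uniform_count_measure Int_iff vimage_eq PiE_iff restrict_extensional UNIV_I
        singleton_iff restrict_apply' simp_thms cong: ball_cong) argo
  then have "cylinder \<theta> s = prod_emb \<theta> ?U (dom s) (PiE (dom s) (\<lambda>i. {the (s i)}))"
    by blast
  then show ?thesis
    using measure_PiM_emb[OF s(2,1), of "\<lambda>i. {the (s i)}"]
    by (simp add: cantor_measure_def sets_uniform_count_measure measure_uniform_count_measure
        power_one_over)
qed

lemma cylinder_nonempty: "\<exists>z. z \<in> cylinder \<theta> s" if "dom s \<subseteq> \<theta>"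
proof
  show "(\<lambda>i. if i \<in> \<theta> then the (s i) else undefined) \<in> cylinder \<theta> s"
    using that by (auto simp: cylinder_def space_cantor_measure split: if_splits)
qed

text \<open>\<open>++\<close> gives priority to \<open>t\<close>; agreement on the common domain
  makes the merged function extend \<open>s\<close> as well, so membership splits into the two
  conditions.\<close>

lemma cylinder_Int:
  assumes "\<And>i. i \<in> dom s \<Longrightarrow> i \<in> dom t \<Longrightarrow> s i = t i"
  shows "cylinder \<theta> s \<inter> cylinder \<theta> t = cylinder \<theta> (s ++ t)"
proof -
  have s: "(s ++ t) i = s i" if "i \<in> dom s" for i
    using assms that by (cases "i \<in> dom t") (simp_all add: map_add_dom_app_simps)
  have t: "(s ++ t) i = t i" if "i \<in> dom t" for i
    using that by (simp add: map_add_dom_app_simps)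
  have "(\<forall>i\<in>dom (s ++ t). (s ++ t) i = Some (z i)) \<longleftrightarrow>
    (\<forall>i\<in>dom s. s i = Some (z i)) \<and> (\<forall>i\<in>dom t. t i = Some (z i))" for z
    by (simp only: dom_map_add ball_Un s t cong: ball_cong) argo
  then have "z \<in> cylinder \<theta> s \<inter> cylinder \<theta> t \<longleftrightarrow> z \<in> cylinder \<theta> (s ++ t)" for z
    by (simp only: cylinder_def Int_iff mem_Collect_eq) argo
  then show ?thesis by blast
qed

lemma cylinder_disjoint:
  assumes "i \<in> dom s" "i \<in> dom t" "s i \<noteq> t i"
  shows "cylinder \<theta> s \<inter> cylinder \<theta> t = {}"
proof -
  have "s i = Some (z i)" if "z \<in> cylinder \<theta> s" for z
    using that assms(1) unfolding cylinder_def by blast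
  moreover have "t i = Some (z i)" if "z \<in> cylinder \<theta> t" for z
    using that assms(2) unfolding cylinder_def by blast
  ultimately show ?thesis using assms(3) by (metis disjoint_iff)
qed

lemma finite_dom_eq: "finite F \<Longrightarrow> finite {a :: 'i \<rightharpoonup> bool. dom a = F}"
  using finite_set_of_finite_maps[of F "UNIV :: bool set"] by simp

text \<open>Disjoint cylinders of equal size reduce measuring to counting. The indexing through
  \<open>f\<close> serves both functions with one fixed domain and pairs of functions merged by
  \<open>++\<close>.\<close>

lemma measure_UN_cylinder:
  assumes "finite P" and "\<And>p. p \<in> P \<Longrightarrow> f p \<in> Fin_maps \<theta>"
    and "\<And>p. p \<in> P \<Longrightarrow> card (dom (f p)) = m"
    and "\<And>p q. p \<in> P \<Longrightarrow> q \<in> P \<Longrightarrow> p \<noteq> q \<Longrightarrow> cylinder \<theta> (f p) \<inter> cylinder \<theta> (f q) = {}"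
  shows "measure (cantor_measure \<theta>) (\<Union>p\<in>P. cylinder \<theta> (f p)) = card P / 2 ^ m"
proof -
  interpret prob_space "cantor_measure \<theta>" by (rule prob_space_cantor_measure)
  have "measure (cantor_measure \<theta>) (\<Union>p\<in>P. cylinder \<theta> (f p))
      = (\<Sum>p\<in>P. measure (cantor_measure \<theta>) (cylinder \<theta> (f p)))"
    using assms by (intro finite_measure_finite_Union)
      (auto simp: disjoint_family_on_def intro: cylinder_in_sets)
  also have "\<dots> = (\<Sum>p\<in>P. 1 / 2 ^ m)"
    using assms by (intro sum.cong) (auto simp: measure_cylinder)
  finally show ?thesis by simp
qed

lemma measure_UN_cylinder_same_dom:
  assumes "finite F" "F \<subseteq> \<theta>" "S \<subseteq> {a. dom a = F}"
  shows "measure (cantor_measure \<theta>) (\<Union>a\<in>S. cylinder \<theta> a) = card S / 2 ^ card F"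
proof (rule measure_UN_cylinder)
  show "finite S" using assms finite_dom_eq finite_subset by blast
  fix a b assume *: "a \<in> S" "b \<in> S" "a \<noteq> b"
  then obtain i where "a i \<noteq> b i" by blast
  moreover have "dom a = F" "dom b = F" using * assms by auto
  ultimately show "cylinder \<theta> a \<inter> cylinder \<theta> b = {}"
    by (intro cylinder_disjoint[of i]) (metis domIff)+
qed (use assms in \<open>auto simp: Fin_maps_def\<close>)

section \<open>Clopen sets, as sets that depend on finitely many coordinates, and approximation by
  them\<close>

definition determined_by :: "'i set \<Rightarrow> 'i set \<Rightarrow> ('i \<Rightarrow> bool) set \<Rightarrow> bool" where
  "determined_by \<theta> F C \<longleftrightarrow> C \<subseteq> space (cantor_measure \<theta>) \<and>
    (\<forall>z\<in>space (cantor_measure \<theta>). \<forall>z'\<in>space (cantor_measure \<theta>).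
      (\<forall>i\<in>F. z i = z' i) \<longrightarrow> z \<in> C \<longrightarrow> z' \<in> C)"

lemma determined_by_cylinder: "dom s \<subseteq> F \<Longrightarrow> determined_by \<theta> F (cylinder \<theta> s)"
  by (auto simp: determined_by_def cylinder_def)

lemma determined_by_Int:
  "determined_by \<theta> F C \<Longrightarrow> determined_by \<theta> F D \<Longrightarrow> determined_by \<theta> F (C \<inter> D)"
  unfolding determined_by_def by blast

lemma determined_by_UN:
  assumes "\<And>i. i \<in> I \<Longrightarrow> determined_by \<theta> F (C i)"
  shows "determined_by \<theta> F (\<Union>i\<in>I. C i)"
  unfolding determined_by_def
proof (intro conjI ballI impI)
  show "(\<Union>i\<in>I. C i) \<subseteq> space (cantor_measure \<theta>)"
    using assms by (auto simp: determined_by_def)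
  fix z z'
  assume z: "z \<in> space (cantor_measure \<theta>)" "z' \<in> space (cantor_measure \<theta>)"
    "\<forall>i\<in>F. z i = z' i" and "z \<in> (\<Union>i\<in>I. C i)"
  then obtain i where i: "i \<in> I" "z \<in> C i" by blast
  have "z' \<in> C i"
    using assms[OF i(1)] z(1-3) i(2) unfolding determined_by_def by blast
  with i(1) show "z' \<in> (\<Union>i\<in>I. C i)" by blast
qed

lemma determined_by_mono: "determined_by \<theta> F C \<Longrightarrow> F \<subseteq> G \<Longrightarrow> determined_by \<theta> G C"
  unfolding determined_by_def by blast

text \<open>Each point of \<open>C\<close> lies in the cylinder of its own restriction to
  \<open>F\<close>, and this cylinder stays inside \<open>C\<close> because \<open>C\<close> cannot
  separate points that agree on \<open>F\<close>.\<close>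

lemma determined_by_eq_UN_cylinder:
  assumes "determined_by \<theta> F C" "F \<subseteq> \<theta>"
  shows "C = (\<Union>a\<in>{a. dom a = F \<and> cylinder \<theta> a \<subseteq> C}. cylinder \<theta> a)"
proof
  show "C \<subseteq> (\<Union>a\<in>{a. dom a = F \<and> cylinder \<theta> a \<subseteq> C}. cylinder \<theta> a)"
  proof
    fix z assume z: "z \<in> C"
    define a where "a = (\<lambda>i. if i \<in> F then Some (z i) else None)"
    have "dom a = F" by (auto simp: a_def split: if_splits)
    moreover have "z \<in> cylinder \<theta> a"
      using z assms(1) by (auto simp: cylinder_def determined_by_def a_def split: if_splits)
    moreover have "z' \<in> C" if "z' \<in> cylinder \<theta> a" for z'
    proof -
      have "z' \<in> space (cantor_measure \<theta>)" "\<forall>i\<in>F. z i = z' i"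
        using that \<open>dom a = F\<close> by (auto simp: cylinder_def a_def)
      then show ?thesis using assms(1) z unfolding determined_by_def by blast
    qed
    ultimately show "z \<in> (\<Union>a\<in>{a. dom a = F \<and> cylinder \<theta> a \<subseteq> C}. cylinder \<theta> a)"
      by blast
  qed
qed blast

lemma determined_by_in_sets:
  assumes "determined_by \<theta> F C" "F \<subseteq> \<theta>" "finite F"
  shows "C \<in> sets (cantor_measure \<theta>)"
proof (subst determined_by_eq_UN_cylinder[OF assms(1,2)], rule sets.finite_UN)
  show "finite {a. dom a = F \<and> cylinder \<theta> a \<subseteq> C}"
    using finite_dom_eq[OF assms(3)] by (rule rev_finite_subset) auto
qed (use assms in \<open>auto intro: cylinder_in_sets simp: Fin_maps_def\<close>)

text \<open>The sets that can be approximated within every error contain the one-coordinate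
  generators and are closed under complement and countable union. For a union, continuity from below
  leaves a finite part of it at the cost of half the error; the other half is spent on approximating
  that finite part.\<close>

lemma clopen_approximation:
  assumes "X \<in> sets (cantor_measure \<theta>)" "\<epsilon> > 0"
  shows "\<exists>F C. finite F \<and> F \<subseteq> \<theta> \<and> determined_by \<theta> F C \<and>
    measure (cantor_measure \<theta>) (sym_diff X C) < \<epsilon>"
proof -
  let ?M = "cantor_measure \<theta>"
  let ?G = "{{z\<in>PiE \<theta> (\<lambda>_. UNIV). z i \<in> A} |i A. i \<in> \<theta> \<and> A \<subseteq> (UNIV::bool set)}"
  interpret prob_space ?M by (rule prob_space_cantor_measure)
  have sets: "sets ?M = sigma_sets (PiE \<theta> (\<lambda>_. UNIV)) ?G"
    by (simp add: cantor_measure_def sets_PiM_single sets_uniform_count_measure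
        space_uniform_count_measure)
  have "X \<in> sigma_sets (PiE \<theta> (\<lambda>_. UNIV)) ?G" using assms(1) sets by simp
  then show ?thesis using assms(2)
  proof (induction arbitrary: \<epsilon> rule: sigma_sets.induct)
    case (Basic a)
    then obtain i A where "i \<in> \<theta>" "a = {z\<in>PiE \<theta> (\<lambda>_. UNIV). z i \<in> A}" by blast
    then have "determined_by \<theta> {i} a"
      by (auto simp: determined_by_def space_cantor_measure)
    then show ?case using \<open>i \<in> \<theta>\<close> Basic by (intro exI[of _ "{i}"] exI[of _ a]) auto
  next
    case Empty
    have "determined_by \<theta> {} {}" by (simp add: determined_by_def)
    then show ?case using Empty by (intro exI[of _ "{}"]) auto
  next
    case (Compl a)
    then obtain F C where C: "finite F" "F \<subseteq> \<theta>" "determined_by \<theta> F C"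
      "measure ?M (sym_diff a C) < \<epsilon>" by blast
    have "a \<in> sets ?M" using Compl sets by simp
    then have "a \<subseteq> space ?M" by (rule sets.sets_into_space)
    moreover have "C \<subseteq> space ?M" using C by (simp add: determined_by_def)
    ultimately have "sym_diff (PiE \<theta> (\<lambda>_. UNIV) - a) (space ?M - C) = sym_diff a C"
      by (auto simp: space_cantor_measure)
    moreover have "determined_by \<theta> F (space ?M - C)"
      using C(3) unfolding determined_by_def by (metis Diff_iff Diff_subset)
    ultimately show ?case using C by metis
  next
    case (Union a)
    have a: "a i \<in> sets ?M" for i using Union sets by simp
    have "(\<lambda>n. measure ?M (\<Union>i<n. a i)) \<longlonglongrightarrow> measure ?M (\<Union>n. \<Union>i<n. a i)"
      by (rule finite_Lim_measure_incseq) (use a in \<open>auto simp: incseq_def\<close>, force)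
    moreover have "(\<Union>n. \<Union>i<n. a i) = (\<Union>i. a i)" by blast
    ultimately have "(\<lambda>n. measure ?M (\<Union>i<n. a i)) \<longlonglongrightarrow> measure ?M (\<Union>i. a i)"
      by simp
    then have "eventually (\<lambda>n. measure ?M (\<Union>i<n. a i) > measure ?M (\<Union>i. a i) - \<epsilon> / 2) sequentially"
      using Union.prems by (intro order_tendstoD) auto
    then obtain n where n: "measure ?M (\<Union>i<n. a i) > measure ?M (\<Union>i. a i) - \<epsilon> / 2"
      by (auto simp: eventually_sequentially)
    \<comment> \<open>The \<open>n\<close> errors add up to at most half of \<epsilon>;
      \<open>n + 1\<close> in place of \<open>n\<close> keeps the denominator nonzero for
      \<open>n = 0\<close>.\<close>
    have "\<forall>i. \<exists>F C. finite F \<and> F \<subseteq> \<theta> \<and> determined_by \<theta> F C \<and>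
      measure ?M (sym_diff (a i) C) < \<epsilon> / (2 * (n + 1))"
      using Union.IH Union.prems by simp
    then obtain F C where F: "\<And>i. finite (F i)" "\<And>i. F i \<subseteq> \<theta>" "\<And>i. determined_by \<theta> (F i) (C i)"
      "\<And>i. measure ?M (sym_diff (a i) (C i)) < \<epsilon> / (2 * (n + 1))"
      by metis
    have C: "C i \<in> sets ?M" for i by (rule determined_by_in_sets[OF F(3,2,1)])
    let ?F = "\<Union>i<n. F i" and ?C = "\<Union>i<n. C i"
    have d: "determined_by \<theta> ?F ?C"
      by (intro determined_by_UN determined_by_mono[OF F(3)]) auto
    have "sym_diff (\<Union>i. a i) ?C \<subseteq> ((\<Union>i. a i) - (\<Union>i<n. a i)) \<union> (\<Union>i<n. sym_diff (a i) (C i))"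
      by blast
    then have "measure ?M (sym_diff (\<Union>i. a i) ?C)
      \<le> measure ?M (((\<Union>i. a i) - (\<Union>i<n. a i)) \<union> (\<Union>i<n. sym_diff (a i) (C i)))"
      using a C by (intro finite_measure_mono) (auto intro!: sets.Un sets.Diff)
    also have "\<dots> \<le> measure ?M ((\<Union>i. a i) - (\<Union>i<n. a i)) + measure ?M (\<Union>i<n. sym_diff (a i) (C i))"
      using a C by (intro measure_Un_le) (auto intro!: sets.Un sets.Diff)
    also have "measure ?M ((\<Union>i. a i) - (\<Union>i<n. a i)) = measure ?M (\<Union>i. a i) - measure ?M (\<Union>i<n. a i)"
      using a by (intro finite_measure_Diff) auto
    also have "measure ?M (\<Union>i<n. sym_diff (a i) (C i)) \<le> (\<Sum>i<n. measure ?M (sym_diff (a i) (C i)))"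
      using a C by (intro measure_UNION_le) (auto intro!: sets.Un sets.Diff)
    also have "\<dots> \<le> (\<Sum>i<n. \<epsilon> / (2 * (n + 1)))"
      using F(4) by (intro sum_mono) (simp add: less_imp_le)
    also have "\<dots> \<le> \<epsilon> / 2"
      using Union.prems by (simp add: field_simps)
    finally have "measure ?M (sym_diff (\<Union>i. a i) ?C) < \<epsilon>" using n by simp
    then show ?case using d F(1,2) by (intro exI[of _ ?F] exI[of _ ?C]) auto
  qed
qed

text \<open>Since the domain of \<open>a\<close> lies in \<theta>, its cylinder has a point, and
  from that point the values of both functions can be read off. This turns inclusion of cylinders
  into a combinatorial condition.\<close>

lemma cylinder_subset_iff:
  assumes "dom s \<subseteq> dom a" "dom a \<subseteq> \<theta>"
  shows "cylinder \<theta> a \<subseteq> cylinder \<theta> s \<longleftrightarrow> s \<subseteq>\<^sub>m a"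
proof
  assume sub: "cylinder \<theta> a \<subseteq> cylinder \<theta> s"
  obtain z where z: "z \<in> cylinder \<theta> a" using cylinder_nonempty[OF assms(2)] ..
  then have "z \<in> cylinder \<theta> s" using sub by blast
  with z have "\<forall>i\<in>dom a. a i = Some (z i)" "\<forall>i\<in>dom s. s i = Some (z i)"
    unfolding cylinder_def by blast+
  then have "s i = a i" if "i \<in> dom s" for i using that assms(1) by (metis subsetD)
  then show "s \<subseteq>\<^sub>m a" unfolding map_le_def by blast
next
  assume "s \<subseteq>\<^sub>m a"
  then have le: "s i = a i" if "i \<in> dom s" for i using that unfolding map_le_def by blast
  show "cylinder \<theta> a \<subseteq> cylinder \<theta> s"
  proof
    fix z assume "z \<in> cylinder \<theta> a"
    then have z: "z \<in> space (cantor_measure \<theta>)" "\<forall>i\<in>dom a. a i = Some (z i)"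
      unfolding cylinder_def by blast+
    have "s i = Some (z i)" if i: "i \<in> dom s" for i
    proof -
      have "i \<in> dom a" using i assms(1) by blast
      then show ?thesis using z(2) le[OF i] by (metis (no_types))
    qed
    with z(1) show "z \<in> cylinder \<theta> s" unfolding cylinder_def by blast
  qed
qed

text \<open>Counting by measuring: in the cube over \<open>R\<close>, the cylinder of
  \<open>s\<close> splits into the cylinders of its total extensions to \<open>R\<close>, each of
  measure \<open>1 / 2 ^ card R\<close>. The product form avoids subtraction in an exponent.\<close>

lemma card_map_extensions:
  fixes s :: "'i \<rightharpoonup> bool"
  assumes "finite R" "dom s \<subseteq> R"
  shows "real (card {a. dom a = R \<and> s \<subseteq>\<^sub>m a}) * 2 ^ card (dom s) = 2 ^ card R"
proof -
  have "cylinder R s = (\<Union>a\<in>{a. dom a = R \<and> cylinder R a \<subseteq> cylinder R s}. cylinder R a)"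
    by (rule determined_by_eq_UN_cylinder[OF determined_by_cylinder[OF assms(2)]]) simp
  also have "{a. dom a = R \<and> cylinder R a \<subseteq> cylinder R s} = {a. dom a = R \<and> s \<subseteq>\<^sub>m a}"
    using cylinder_subset_iff[of s _ R] assms(2) by blast
  also have "measure (cantor_measure R) (\<Union>a\<in>{a. dom a = R \<and> s \<subseteq>\<^sub>m a}. cylinder R a)
      = card {a. dom a = R \<and> s \<subseteq>\<^sub>m a} / 2 ^ card R"
    by (rule measure_UN_cylinder_same_dom[OF assms(1) order.refl]) blast
  finally have "measure (cantor_measure R) (cylinder R s)
      = card {a. dom a = R \<and> s \<subseteq>\<^sub>m a} / 2 ^ card R" .
  moreover have "s \<in> Fin_maps R" using assms finite_subset by (auto simp: Fin_maps_def)
  ultimately show ?thesis by (simp add: measure_cylinder field_simps)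
qed

text \<open>A clopen approximation \<open>C\<close> of the intersection is cut down to the cylinder
  of \<open>s\<close>. This cannot increase the error, as the approximated set lies in that cylinder
  already. Adding the domain of \<open>s\<close> to the coordinates keeps the set determined, and it
  becomes a union over extensions of \<open>s\<close>.\<close>

lemma approximation_within_cylinder:
  assumes X: "X \<in> sets (cantor_measure \<theta>)" and s: "s \<in> Fin_maps \<theta>" and "\<epsilon> > 0"
  shows "\<exists>F S. finite F \<and> dom s \<subseteq> F \<and> F \<subseteq> \<theta> \<and> S \<subseteq> {a. dom a = F \<and> s \<subseteq>\<^sub>m a} \<and>
    measure (cantor_measure \<theta>) (sym_diff (X \<inter> cylinder \<theta> s) (\<Union>a\<in>S. cylinder \<theta> a)) < \<epsilon>"
proof -
  let ?M = "cantor_measure \<theta>" and ?Xs = "X \<inter> cylinder \<theta> s"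
  interpret prob_space ?M by (rule prob_space_cantor_measure)
  have Xs: "?Xs \<in> sets ?M" using X cylinder_in_sets[OF s] by simp
  have ds: "finite (dom s)" "dom s \<subseteq> \<theta>" using s by (auto simp: Fin_maps_def)
  obtain G C where G: "finite G" "G \<subseteq> \<theta>" "determined_by \<theta> G C"
    "measure ?M (sym_diff ?Xs C) < \<epsilon>"
    using clopen_approximation[OF Xs \<open>\<epsilon> > 0\<close>] by blast
  let ?F = "G \<union> dom s" and ?D = "C \<inter> cylinder \<theta> s"
  let ?S = "{a. dom a = ?F \<and> cylinder \<theta> a \<subseteq> ?D}"
  have F: "finite ?F" "?F \<subseteq> \<theta>" using G(1,2) ds by auto
  have "determined_by \<theta> ?F ?D"
    by (intro determined_by_Int determined_by_mono[OF G(3)] determined_by_cylinder) auto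
  then have D: "?D = (\<Union>a\<in>?S. cylinder \<theta> a)"
    using F(2) by (rule determined_by_eq_UN_cylinder)
  have "?S \<subseteq> {a. dom a = ?F \<and> s \<subseteq>\<^sub>m a}"
  proof
    fix a assume a: "a \<in> ?S"
    then have "cylinder \<theta> a \<subseteq> cylinder \<theta> s" by simp
    moreover have "dom s \<subseteq> dom a" "dom a \<subseteq> \<theta>" using a F(2) by simp_all
    ultimately show "a \<in> {a. dom a = ?F \<and> s \<subseteq>\<^sub>m a}"
      using a cylinder_subset_iff[of s a \<theta>] by simp
  qed
  moreover have "measure ?M (sym_diff ?Xs (\<Union>a\<in>?S. cylinder \<theta> a)) < \<epsilon>"
  proof -
    have "C \<in> sets ?M" using determined_by_in_sets[OF G(3,2,1)] .
    then have "measure ?M (sym_diff ?Xs ?D) \<le> measure ?M (sym_diff ?Xs C)"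
      using Xs by (intro finite_measure_mono) (auto intro!: sets.Un sets.Diff)
    also note G(4)
    finally show ?thesis
      using arg_cong[OF D, of "\<lambda>U. measure ?M (sym_diff ?Xs U)"] by (rule subst[rotated])
  qed
  ultimately show ?thesis using F
    by (intro exI[of _ ?F] exI[of _ ?S] conjI) auto
qed

section \<open>Two clopen sets: independence over their common coordinates\<close>

lemma measure_UN_cylinder_Int:
  assumes F: "finite F" "F \<subseteq> \<theta>" "S \<subseteq> {a. dom a = F}"
    and G: "finite G" "G \<subseteq> \<theta>" "T \<subseteq> {a. dom a = G}"
  shows "measure (cantor_measure \<theta>) ((\<Union>a\<in>S. cylinder \<theta> a) \<inter> (\<Union>b\<in>T. cylinder \<theta> b))
    = (\<Sum>r | dom r = F \<inter> G. real (card {a\<in>S. a |` (F \<inter> G) = r}) * card {b\<in>T. b |` (F \<inter> G) = r})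
      / 2 ^ card (F \<union> G)"
proof -
  let ?R = "F \<inter> G"
  \<comment> \<open>A pair in \<open>?P r\<close> induces the same \<open>r\<close> on the common
    coordinates, so it merges into one function on the union of the domains. \<open>?Q\<close>
    collects all compatible pairs, and the sum in the claim counts them according to
    \<open>r\<close>.\<close>
  let ?P = "\<lambda>r. {a\<in>S. a |` ?R = r} \<times> {b\<in>T. b |` ?R = r}"
  let ?Q = "\<Union>r\<in>{r. dom r = ?R}. ?P r"
  have fin: "finite S" "finite T" "finite {r :: 'a \<rightharpoonup> bool. dom r = ?R}"
    using finite_subset[OF F(3)] finite_subset[OF G(3)] F(1) G(1) finite_dom_eq by auto
  have dom: "dom a = F" if "a \<in> S" for a using that F(3) by blast
  have dom': "dom b = G" if "b \<in> T" for b using that G(3) by blast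
  have agree: "a |` ?R = b |` ?R \<longleftrightarrow> (\<forall>i\<in>dom a \<inter> dom b. a i = b i)" if "a \<in> S" "b \<in> T" for a b
    using dom[OF that(1)] dom'[OF that(2)] by (auto simp: restrict_map_def fun_eq_iff)
  have Q: "(a, b) \<in> ?Q \<longleftrightarrow> a \<in> S \<and> b \<in> T \<and> (\<forall>i\<in>dom a \<inter> dom b. a i = b i)" for a b
  proof -
    have "(a, b) \<in> ?Q \<longleftrightarrow> a \<in> S \<and> b \<in> T \<and> a |` ?R = b |` ?R"
    proof
      assume *: "a \<in> S \<and> b \<in> T \<and> a |` ?R = b |` ?R"
      then have "dom a = F" using dom by blast
      then have "dom (a |` ?R) = ?R" by (simp only: dom_restrict) blast
      with * show "(a, b) \<in> ?Q" by (intro UN_I[of "a |` ?R"]) simp_all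
    qed simp
    also have "\<dots> \<longleftrightarrow> a \<in> S \<and> b \<in> T \<and> (\<forall>i\<in>dom a \<inter> dom b. a i = b i)"
      by (simp only: agree cong: conj_cong)
    finally show ?thesis .
  qed
  have cyl: "cylinder \<theta> (fst p ++ snd p) = cylinder \<theta> (fst p) \<inter> cylinder \<theta> (snd p)"
    if "p \<in> ?Q" for p
    using that Q[of "fst p" "snd p"] by (intro cylinder_Int[symmetric]) simp
  have disj: "cylinder \<theta> a \<inter> cylinder \<theta> b = {}" if d: "dom a = dom b" and n: "a \<noteq> b" for a b
  proof -
    obtain i where "a i \<noteq> b i" using n by blast
    with d show ?thesis by (intro cylinder_disjoint[of i]) (metis domIff)+
  qed
  have LU: "(\<Union>a\<in>S. cylinder \<theta> a) \<inter> (\<Union>b\<in>T. cylinder \<theta> b) = (\<Union>p\<in>?Q. cylinder \<theta> (fst p ++ snd p))"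
    (is "?L = ?U")
  proof
    show "?L \<subseteq> ?U"
    proof
      fix z assume "z \<in> ?L"
      then obtain a b where ab: "a \<in> S" "b \<in> T" "z \<in> cylinder \<theta> a \<inter> cylinder \<theta> b" by blast
      have "\<forall>i\<in>dom a \<inter> dom b. a i = b i"
      proof (rule ballI, rule ccontr)
        fix i assume "i \<in> dom a \<inter> dom b" "a i \<noteq> b i"
        then show False using cylinder_disjoint[of i a b \<theta>] ab(3) by blast
      qed
      then have p: "(a, b) \<in> ?Q" using Q ab by blast
      then have "z \<in> cylinder \<theta> (fst (a, b) ++ snd (a, b))" using cyl[OF p] ab(3) by simp
      with p show "z \<in> ?U" by (rule UN_I)
    qed
    show "?U \<subseteq> ?L"
    proof
      fix z assume "z \<in> ?U"
      then obtain p where p: "p \<in> ?Q" "z \<in> cylinder \<theta> (fst p ++ snd p)" by (rule UN_E)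
      then have "z \<in> cylinder \<theta> (fst p)" "z \<in> cylinder \<theta> (snd p)" using cyl by blast+
      moreover have "fst p \<in> S" "snd p \<in> T" using p(1) by auto
      ultimately show "z \<in> ?L" by blast
    qed
  qed
  have mU: "measure (cantor_measure \<theta>) (\<Union>p\<in>?Q. cylinder \<theta> (fst p ++ snd p))
      = card ?Q / 2 ^ card (F \<union> G)"
  proof (rule measure_UN_cylinder)
    show "finite ?Q" using fin by (intro finite_UN_I) auto
  next
    fix p assume p: "p \<in> ?Q"
    then have "fst p \<in> S" "snd p \<in> T" by auto
    then have "dom (fst p) = F" "dom (snd p) = G" using dom dom' by blast+
    then have d: "dom (fst p ++ snd p) = F \<union> G" by (simp only: dom_map_add Un_commute)
    then show "fst p ++ snd p \<in> Fin_maps \<theta>" using F G by (simp add: Fin_maps_def)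
    show "card (dom (fst p ++ snd p)) = card (F \<union> G)" by (simp only: d)
  next
    \<comment> \<open>Distinct pairs differ in a component, and distinct functions with the same
      domain have disjoint cylinders.\<close>
    fix p q assume p: "p \<in> ?Q" and q: "q \<in> ?Q" and "p \<noteq> q"
    then have "fst p \<noteq> fst q \<or> snd p \<noteq> snd q" by (simp add: prod_eq_iff)
    moreover have "dom (fst p) = dom (fst q)" "dom (snd p) = dom (snd q)"
    proof -
      have "fst p \<in> S" "fst q \<in> S" "snd p \<in> T" "snd q \<in> T" using p q by auto
      then show "dom (fst p) = dom (fst q)" "dom (snd p) = dom (snd q)"
        by (simp_all only: dom dom')
    qed
    ultimately have "cylinder \<theta> (fst p) \<inter> cylinder \<theta> (fst q) = {} \<or>
        cylinder \<theta> (snd p) \<inter> cylinder \<theta> (snd q) = {}"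
      using disj by blast
    then show "cylinder \<theta> (fst p ++ snd p) \<inter> cylinder \<theta> (fst q ++ snd q) = {}"
      unfolding cyl[OF p] cyl[OF q] by blast
  qed
  have cQ: "card ?Q = (\<Sum>r | dom r = ?R. card (?P r))"
  proof (rule card_UN_disjoint)
    show "\<forall>r\<in>{r. dom r = ?R}. finite (?P r)" using fin(1,2) by simp
    have restr: "fst p |` ?R = r" if "p \<in> ?P r" for r p using that by auto
    have "r = r'" if "p \<in> ?P r \<inter> ?P r'" for r r' p
      using restr[of p r] restr[of p r'] that by blast
    then show "\<forall>r\<in>{r. dom r = ?R}. \<forall>r'\<in>{r. dom r = ?R}. r \<noteq> r' \<longrightarrow> ?P r \<inter> ?P r' = {}"
      by (metis (no_types, lifting) equals0I)
  qed (fact fin(3))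
  show ?thesis
    unfolding LU mU cQ by (simp only: card_cartesian_product of_nat_sum of_nat_mult)
qed

text \<open>With equal counts N_r on both sides, \<open>measure_UN_cylinder_Int\<close> gives a sum
  of squares N_r^2. Only those \<open>r\<close> that extend \<rho> contribute, and by
  \<open>card_map_extensions\<close> their number is smaller than that of all \<open>r\<close> by
  the factor \<open>2 ^ card (dom \<rho>)\<close>. Cauchy-Schwarz over them produces this factor in
  the bound.\<close>

lemma measure_UN_cylinder_Int_ge:
  fixes \<rho> :: "'i \<rightharpoonup> bool"
  assumes F: "finite F" "F \<subseteq> \<theta>" "S \<subseteq> {a. dom a = F}"
    and G: "finite G" "G \<subseteq> \<theta>" "T \<subseteq> {a. dom a = G}"
    and card: "card F = card G"
    and \<rho>: "dom \<rho> \<subseteq> F \<inter> G" "\<And>a. a \<in> S \<Longrightarrow> \<rho> \<subseteq>\<^sub>m a"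
    and same: "\<And>r. dom r = F \<inter> G \<Longrightarrow>
      card {a\<in>S. a |` (F \<inter> G) = r} = card {b\<in>T. b |` (F \<inter> G) = r}"
  shows "measure (cantor_measure \<theta>) ((\<Union>a\<in>S. cylinder \<theta> a) \<inter> (\<Union>b\<in>T. cylinder \<theta> b))
    \<ge> (measure (cantor_measure \<theta>) (\<Union>a\<in>S. cylinder \<theta> a))\<^sup>2 * 2 ^ card (dom \<rho>)"
proof -
  let ?R = "F \<inter> G" and ?D = "{r. dom r = F \<inter> G \<and> \<rho> \<subseteq>\<^sub>m r}"
  let ?A = "\<lambda>r. {a\<in>S. a |` ?R = r}"
  have fin: "finite S" "finite {r :: 'i \<rightharpoonup> bool. dom r = ?R}" "finite ?D"
    using finite_subset[OF F(3)] F(1) finite_dom_eq[of ?R] finite_dom_eq[of F]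
    by (auto intro: rev_finite_subset)
  have D: "a |` ?R \<in> ?D" if "a \<in> S" for a
  proof -
    have "dom a = F" using that F(3) by blast
    then have "dom (a |` ?R) = ?R" by auto
    moreover have "\<rho> i = (a |` ?R) i" if i: "i \<in> dom \<rho>" for i
    proof -
      have "i \<in> ?R" using i \<rho>(1) by blast
      moreover have "\<rho> i = a i" using \<rho>(2)[OF \<open>a \<in> S\<close>] i unfolding map_le_def by blast
      ultimately show ?thesis by simp
    qed
    ultimately show ?thesis unfolding map_le_def by simp
  qed
  have empty: "?A r = {}" if "r \<notin> ?D" for r
    using D that by blast
  have "S = (\<Union>r\<in>?D. ?A r)" using D by blast
  then have "card S = card (\<Union>r\<in>?D. ?A r)" by (rule arg_cong)
  also have "\<dots> = (\<Sum>r\<in>?D. card (?A r))"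
    using fin by (intro card_UN_disjoint) auto
  finally have S: "real (card S) = (\<Sum>r\<in>?D. real (card (?A r)))" by simp
  let ?m = "card F" and ?k = "card ?R" and ?l = "card (dom \<rho>)"
  have cardD: "real (card ?D) * 2 ^ ?l = 2 ^ ?k"
    by (rule card_map_extensions) (use F \<rho> in auto)
  \<comment> \<open>As \<open>F\<close> and \<open>G\<close> have equal size, the square of
    \<open>2 ^ card F\<close> is \<open>2 ^ card (F \<union> G)\<close> times
    \<open>2 ^ card ?R\<close>; the last factor cancels the one that Cauchy-Schwarz
    contributes.\<close>
  have un: "card (F \<union> G) + ?k = ?m + ?m" using card_Un_Int[OF F(1) G(1)] card by simp
  have "measure (cantor_measure \<theta>) ((\<Union>a\<in>S. cylinder \<theta> a) \<inter> (\<Union>b\<in>T. cylinder \<theta> b))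
      = (\<Sum>r | dom r = ?R. (real (card (?A r)))\<^sup>2) / 2 ^ card (F \<union> G)"
    unfolding measure_UN_cylinder_Int[OF F G] by (simp add: same power2_eq_square)
  also have "(\<Sum>r | dom r = ?R. (real (card (?A r)))\<^sup>2) = (\<Sum>r\<in>?D. (real (card (?A r)))\<^sup>2)"
    using fin empty by (intro sum.mono_neutral_right) auto
  finally have eq: "measure (cantor_measure \<theta>) ((\<Union>a\<in>S. cylinder \<theta> a) \<inter> (\<Union>b\<in>T. cylinder \<theta> b))
      = (\<Sum>r\<in>?D. (real (card (?A r)))\<^sup>2) / 2 ^ card (F \<union> G)" .
  have "(real (card S))\<^sup>2 * 2 ^ ?l \<le> (\<Sum>r\<in>?D. (real (card (?A r)))\<^sup>2) * card ?D * 2 ^ ?l"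
    unfolding S by (intro mult_right_mono sum_squared_le_sum_of_squares) auto
  also have "\<dots> = (\<Sum>r\<in>?D. (real (card (?A r)))\<^sup>2) * 2 ^ ?k"
    using cardD by (simp add: mult.assoc)
  finally have "(real (card S))\<^sup>2 * 2 ^ ?l / 2 ^ (?m + ?m)
      \<le> (\<Sum>r\<in>?D. (real (card (?A r)))\<^sup>2) * 2 ^ ?k / 2 ^ (?m + ?m)"
    by (rule divide_right_mono) simp
  also have "\<dots> = (\<Sum>r\<in>?D. (real (card (?A r)))\<^sup>2) / 2 ^ card (F \<union> G)"
    unfolding un[symmetric] power_add by simp
  finally show ?thesis
    unfolding eq measure_UN_cylinder_same_dom[OF F]
    by (simp add: power_divide power_add power2_eq_square)
qed

text \<open>Equality of the restrictions forces every point of \<open>R\<close> in one domain to lie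
  in the other, so the domain of the restriction is exactly the common domain. The formula is then
  inclusion-exclusion in the exponents.\<close>

lemma measure_cylinder_Int:
  assumes s: "s \<in> Fin_maps \<theta>" and t: "t \<in> Fin_maps \<theta>"
    and R: "dom s \<inter> dom t \<subseteq> R" and st: "s |` R = t |` R"
  shows "measure (cantor_measure \<theta>) (cylinder \<theta> s \<inter> cylinder \<theta> t)
    = 2 ^ card (dom (s |` R)) / (2 ^ card (dom s) * 2 ^ card (dom t))"
proof -
  have agree: "s i = t i" if "i \<in> R" for i using fun_cong[OF st, of i] that by simp
  have i: "dom (s |` R) = dom s \<inter> dom t"
  proof -
    have "dom (s |` R) \<subseteq> dom t" unfolding st by auto
    then show ?thesis using R by auto
  qed
  have fin: "finite (dom s)" "finite (dom t)" using s t by (auto simp: Fin_maps_def)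
  have "cylinder \<theta> s \<inter> cylinder \<theta> t = cylinder \<theta> (s ++ t)"
    using R agree by (intro cylinder_Int) blast
  moreover have "s ++ t \<in> Fin_maps \<theta>" using s t by (auto simp: Fin_maps_def)
  moreover have "card (dom s) + card (dom t) = card (dom (s ++ t)) + card (dom (s |` R))"
    using card_Un_Int[OF fin] i by (simp add: dom_map_add Un_commute)
  then have "(2::real) ^ card (dom s) * 2 ^ card (dom t) = 2 ^ card (dom (s ++ t)) * 2 ^ card (dom (s |` R))"
    by (simp only: power_add[symmetric])
  ultimately show ?thesis by (simp add: measure_cylinder)
qed

section \<open>Passing between measurable sets and their clopen approximations\<close>

lemma (in finite_measure) measure_Int_le_sym_diff:
  assumes "U \<in> sets M" "V \<in> sets M" "A \<in> sets M" "B \<in> sets M"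
  shows "measure M (A \<inter> B)
    \<le> measure M (U \<inter> V) + (measure M (sym_diff U A) + measure M (sym_diff V B))"
proof -
  have sd: "sym_diff U A \<in> sets M" "sym_diff V B \<in> sets M" using assms by auto
  have "measure M (A \<inter> B) \<le> measure M ((U \<inter> V) \<union> (sym_diff U A \<union> sym_diff V B))"
    using assms by (intro finite_measure_mono) auto
  also have "\<dots> \<le> measure M (U \<inter> V) + measure M (sym_diff U A \<union> sym_diff V B)"
    using assms sd by (intro measure_Un_le) auto
  also have "measure M (sym_diff U A \<union> sym_diff V B)
      \<le> measure M (sym_diff U A) + measure M (sym_diff V B)"
    using sd by (rule measure_Un_le)
  finally show ?thesis by simp
qed

text \<open>The two error terms together cost less than the gap between \<open>q\<^sup>2\<close> and \<open>\<delta>\<^sup>2\<close>, because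
  \<open>\<mu>([s] \<and> [t]) \<ge> 4\<^sup>-\<^sup>n\<close>.\<close>

lemma measure_Int_gt_of_approximation:
  fixes q \<delta> :: real and \<rho> :: "'i \<rightharpoonup> bool"
  defines "M \<equiv> \<lambda>\<theta> :: 'i set. measure (cantor_measure \<theta>)"
  assumes XY: "X \<in> sets (cantor_measure \<theta>)" "Y \<in> sets (cantor_measure \<theta>)"
    and st: "s \<in> Fin_maps \<theta>" "t \<in> Fin_maps \<theta>" "card (dom s) = n" "card (dom t) = n"
    and F: "finite F" "F \<subseteq> \<theta>" "dom s \<subseteq> F" "S \<subseteq> {a. dom a = F \<and> s \<subseteq>\<^sub>m a}"
    and G: "finite G" "G \<subseteq> \<theta>" "dom t \<subseteq> G" "T \<subseteq> {a. dom a = G \<and> t \<subseteq>\<^sub>m a}"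
    and card: "card F = card G"
    and root: "s |` (F \<inter> G) = t |` (F \<inter> G)"
    and same: "\<And>r. dom r = F \<inter> G \<Longrightarrow>
      card {a\<in>S. a |` (F \<inter> G) = r} = card {b\<in>T. b |` (F \<inter> G) = r}"
    and q: "0 \<le> q" "q / 2 ^ n < M \<theta> (\<Union>a\<in>S. cylinder \<theta> a)"
    and approx: "M \<theta> (sym_diff (X \<inter> cylinder \<theta> s) (\<Union>a\<in>S. cylinder \<theta> a)) < (q\<^sup>2 - \<delta>\<^sup>2) / 4 ^ n / 2"
      "M \<theta> (sym_diff (Y \<inter> cylinder \<theta> t) (\<Union>b\<in>T. cylinder \<theta> b)) < (q\<^sup>2 - \<delta>\<^sup>2) / 4 ^ n / 2"
  shows "M \<theta> (X \<inter> Y \<inter> (cylinder \<theta> s \<inter> cylinder \<theta> t)) > \<delta>\<^sup>2 * M \<theta> (cylinder \<theta> s \<inter> cylinder \<theta> t)"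
proof -
  interpret prob_space "cantor_measure \<theta>" by (rule prob_space_cantor_measure)
  let ?C = "\<Union>a\<in>S. cylinder \<theta> a" and ?D = "\<Union>b\<in>T. cylinder \<theta> b" and ?R = "F \<inter> G"
  let ?Xs = "X \<inter> cylinder \<theta> s" and ?Yt = "Y \<inter> cylinder \<theta> t"
  let ?l = "card (dom (s |` ?R))"
  have S: "S \<subseteq> {a. dom a = F}" and T: "T \<subseteq> {a. dom a = G}" using F(4) G(4) by blast+
  have "finite S" "finite T"
    using finite_subset[OF S finite_dom_eq] finite_subset[OF T finite_dom_eq] F(1) G(1) by blast+
  then have CD: "?C \<in> sets (cantor_measure \<theta>)" "?D \<in> sets (cantor_measure \<theta>)"
    using S T F(1,2) G(1,2)
    by (auto intro!: sets.finite_UN cylinder_in_sets simp: Fin_maps_def)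
  have Xs: "?Xs \<in> sets (cantor_measure \<theta>)" "?Yt \<in> sets (cantor_measure \<theta>)"
    using XY st by (auto intro: cylinder_in_sets)
  \<comment> \<open>The same factor \<open>2 ^ ?l\<close> occurs in the bound of
    \<open>measure_UN_cylinder_Int_ge\<close> when \<rho> is the restriction of \<open>s\<close> to
    the common coordinates. For a set of measure above \<open>q / 2 ^ n\<close> that bound therefore
    yields q^2 times the measure of this intersection.\<close>
  have st': "M \<theta> (cylinder \<theta> s \<inter> cylinder \<theta> t) = 2 ^ ?l / 4 ^ n"
    unfolding M_def
  proof (subst measure_cylinder_Int[OF st(1,2) _ root])
    show "dom s \<inter> dom t \<subseteq> ?R" using F(3) G(3) by blast
    show "2 ^ ?l / (2 ^ card (dom s) * 2 ^ card (dom t)) = (2::real) ^ ?l / 4 ^ n"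
      unfolding st(3,4) by (simp add: power_mult_distrib[symmetric])
  qed
  have "q\<^sup>2 * M \<theta> (cylinder \<theta> s \<inter> cylinder \<theta> t) = (q / 2 ^ n)\<^sup>2 * 2 ^ ?l"
  proof -
    have "((2::real) ^ n)\<^sup>2 = (2\<^sup>2) ^ n" by (simp only: power_mult[symmetric] mult.commute)
    also have "\<dots> = 4 ^ n" by simp
    finally show ?thesis unfolding st' power_divide by simp
  qed
  also have "\<dots> \<le> (M \<theta> ?C)\<^sup>2 * 2 ^ ?l"
    using q by (intro mult_right_mono power_mono) auto
  also have "\<dots> \<le> M \<theta> (?C \<inter> ?D)"
    unfolding M_def
  proof (rule measure_UN_cylinder_Int_ge[OF F(1,2) S G(1,2) T card _ _ same])
    show "dom (s |` ?R) \<subseteq> ?R" by auto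
    show "s |` ?R \<subseteq>\<^sub>m a" if "a \<in> S" for a
    proof -
      have "s \<subseteq>\<^sub>m a" using that F(4) by blast
      then show ?thesis by (auto simp: map_le_def)
    qed
  qed
  also have "\<dots> \<le> M \<theta> (?Xs \<inter> ?Yt) + (M \<theta> (sym_diff ?Xs ?C) + M \<theta> (sym_diff ?Yt ?D))"
    unfolding M_def using Xs CD by (rule measure_Int_le_sym_diff)
  also have "?Xs \<inter> ?Yt = X \<inter> Y \<inter> (cylinder \<theta> s \<inter> cylinder \<theta> t)" by blast
  finally have *: "q\<^sup>2 * M \<theta> (cylinder \<theta> s \<inter> cylinder \<theta> t)
    < M \<theta> (X \<inter> Y \<inter> (cylinder \<theta> s \<inter> cylinder \<theta> t)) + (q\<^sup>2 - \<delta>\<^sup>2) / 4 ^ n"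
    using approx by argo
  \<comment> \<open>The gap between the squares is positive because it strictly bounds an error,
    which is nonnegative. Since \<open>2 ^ ?l\<close> is at least 1, the total error is then below
    the gap times the measure of the intersection.\<close>
  have "0 \<le> M \<theta> (sym_diff ?Xs ?C)" unfolding M_def by simp
  then have "0 < (q\<^sup>2 - \<delta>\<^sup>2) / 4 ^ n / 2" using approx(1) by (rule le_less_trans)
  then have "0 < (q\<^sup>2 - \<delta>\<^sup>2) / 4 ^ n" by (simp only: half_gt_zero_iff)
  then have "(q\<^sup>2 - \<delta>\<^sup>2) / 4 ^ n * 1 \<le> (q\<^sup>2 - \<delta>\<^sup>2) / 4 ^ n * 2 ^ ?l"
    by (intro mult_left_mono) auto
  also have "\<dots> = (q\<^sup>2 - \<delta>\<^sup>2) * M \<theta> (cylinder \<theta> s \<inter> cylinder \<theta> t)"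
    unfolding st' by simp
  finally show ?thesis using * by (simp add: left_diff_distrib)
qed

text \<open>A rational \<open>q\<close> strictly between \<delta> and the conditional probability
  leaves a positive gap to absorb the errors, and it takes only countably many values, so
  uncountably many members can share one \<open>q\<close>.\<close>

lemma exists_rational_approximation:
  fixes \<delta> :: real
  assumes X: "X \<in> sets (cantor_measure \<theta>)" and s: "s \<in> Fin_maps \<theta>" and "\<delta> \<ge> 0"
    and gt: "\<delta> / 2 ^ card (dom s) < measure (cantor_measure \<theta>) (X \<inter> cylinder \<theta> s)"
  shows "\<exists>(q::rat) F S. \<delta> < of_rat q \<and> finite F \<and> dom s \<subseteq> F \<and> F \<subseteq> \<theta> \<and>
    S \<subseteq> {a. dom a = F \<and> s \<subseteq>\<^sub>m a} \<and>
    of_rat q / 2 ^ card (dom s) < measure (cantor_measure \<theta>) (\<Union>a\<in>S. cylinder \<theta> a) \<and>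
    measure (cantor_measure \<theta>) (sym_diff (X \<inter> cylinder \<theta> s) (\<Union>a\<in>S. cylinder \<theta> a))
      < ((of_rat q)\<^sup>2 - \<delta>\<^sup>2) / 4 ^ card (dom s) / 2"
proof -
  interpret prob_space "cantor_measure \<theta>" by (rule prob_space_cantor_measure)
  let ?n = "card (dom s)" and ?Xs = "X \<inter> cylinder \<theta> s"
  have "\<delta> < measure (cantor_measure \<theta>) ?Xs * 2 ^ ?n" using gt by (simp add: field_simps)
  then obtain q :: rat where q: "\<delta> < of_rat q" "of_rat q < measure (cantor_measure \<theta>) ?Xs * 2 ^ ?n"
    using of_rat_dense by blast
  \<comment> \<open>The first term keeps the measure of the approximating set above
    \<open>of_rat q / 2 ^ ?n\<close>. The second is half of the scaled gap, so that the errors of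
    two members fit into it together.\<close>
  define \<epsilon> where "\<epsilon> = min (measure (cantor_measure \<theta>) ?Xs - of_rat q / 2 ^ ?n)
    (((of_rat q)\<^sup>2 - \<delta>\<^sup>2) / 4 ^ ?n / 2)"
  have "\<delta>\<^sup>2 < (of_rat q)\<^sup>2" using q(1) \<open>\<delta> \<ge> 0\<close> by (intro power_strict_mono) auto
  then have "\<epsilon> > 0" using q(2) by (simp add: \<epsilon>_def field_simps)
  then obtain F S where F: "finite F" "dom s \<subseteq> F" "F \<subseteq> \<theta>" "S \<subseteq> {a. dom a = F \<and> s \<subseteq>\<^sub>m a}"
    and less: "measure (cantor_measure \<theta>) (sym_diff ?Xs (\<Union>a\<in>S. cylinder \<theta> a)) < \<epsilon>"
    using approximation_within_cylinder[OF X s \<open>\<epsilon> > 0\<close>] by (elim exE conjE) (rule that)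
  let ?C = "\<Union>a\<in>S. cylinder \<theta> a"
  have "S \<subseteq> {a. dom a = F}" using F(4) by blast
  then have "finite S" using finite_dom_eq[OF F(1)] by (rule finite_subset)
  moreover have "cylinder \<theta> a \<in> sets (cantor_measure \<theta>)" if "a \<in> S" for a
  proof -
    have "dom a = F" using that F(4) by blast
    then show ?thesis using F(1,3) by (intro cylinder_in_sets) (simp add: Fin_maps_def)
  qed
  ultimately have C: "?C \<in> sets (cantor_measure \<theta>)" by (intro sets.finite_UN)
  have Xs: "?Xs \<in> sets (cantor_measure \<theta>)" by (rule sets.Int[OF X cylinder_in_sets[OF s]])
  have "measure (cantor_measure \<theta>) ?Xs \<le> measure (cantor_measure \<theta>) (?C \<union> sym_diff ?Xs ?C)"
    using C Xs by (intro finite_measure_mono sets.Un sets.Diff) blast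
  also have "\<dots> \<le> measure (cantor_measure \<theta>) ?C + measure (cantor_measure \<theta>) (sym_diff ?Xs ?C)"
    using C Xs by (intro measure_Un_le sets.Un sets.Diff)
  finally have "of_rat q / 2 ^ ?n < measure (cantor_measure \<theta>) ?C"
    using less unfolding \<epsilon>_def by linarith
  moreover have "measure (cantor_measure \<theta>) (sym_diff ?Xs ?C) < ((of_rat q)\<^sup>2 - \<delta>\<^sup>2) / 4 ^ ?n / 2"
    using less unfolding \<epsilon>_def by linarith
  ultimately show ?thesis
    using q(1) F by (intro exI[of _ q] exI[of _ F] exI[of _ S] conjI)
qed

section \<open>Assembling the uncountable subfamily\<close>

lemma finite_maps_on: "finite R \<Longrightarrow> finite {s :: 'i \<rightharpoonup> bool. dom s \<subseteq> R}"
proof -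
  assume "finite R"
  moreover have "{s :: 'i \<rightharpoonup> bool. dom s \<subseteq> R} = (\<Union>D\<in>Pow R. {s. dom s = D})" by blast
  ultimately show ?thesis by (auto intro!: finite_dom_eq elim: finite_subset[rotated])
qed

theorem mainTheorem6:
  fixes \<theta> :: "'i set" and \<delta> :: real
    and \<A> :: "(('i \<Rightarrow> bool) set set \<times> ('i \<rightharpoonup> bool)) set"
  assumes "\<delta> \<ge> 0"
    and "\<A> \<subseteq> malg (cantor_measure \<theta>) \<times> Fin_maps \<theta>"
    and "uncountable \<A>"
    and "\<forall>(x, s)\<in>\<A>. malg_cond (cantor_measure \<theta>) x (cyl_class \<theta> s) > \<delta>"
  shows "\<exists>\<B>\<subseteq>\<A>. uncountable \<B> \<and>
    (\<forall>(x, s)\<in>\<B>. \<forall>(y, t)\<in>\<B>.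
       malg_inf (cantor_measure \<theta>) (cyl_class \<theta> s) (cyl_class \<theta> t) \<noteq> malg_zero (cantor_measure \<theta>) \<and>
       malg_cond (cantor_measure \<theta>) (malg_inf (cantor_measure \<theta>) x y)
         (malg_inf (cantor_measure \<theta>) (cyl_class \<theta> s) (cyl_class \<theta> t)) > \<delta>\<^sup>2)"
proof -
  let ?M = "cantor_measure \<theta>"
  interpret prob_space ?M by (rule prob_space_cantor_measure)
  have fin: "snd p \<in> Fin_maps \<theta>" if "p \<in> \<A>" for p using that assms(2) by auto
  \<comment> \<open>Representatives are fixed for the elements of the algebra; by
    \<open>malg_inf_class\<close> and \<open>malg_measure_class\<close> hypothesis and goal become
    statements about measures of sets.\<close>
  have "\<exists>X. X \<in> sets ?M \<and> fst p = malg_class ?M X" if "p \<in> \<A>" for p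
  proof -
    have "fst p \<in> malg ?M" using that assms(2) by auto
    then show ?thesis by (auto simp: malg_def malg_class_def elim: quotientE)
  qed
  then obtain X where X: "\<And>p. p \<in> \<A> \<Longrightarrow> X p \<in> sets ?M"
    and X_class: "\<And>p. p \<in> \<A> \<Longrightarrow> fst p = malg_class ?M (X p)"
    by metis
  have gt: "\<delta> / 2 ^ card (dom (snd p)) < measure ?M (X p \<inter> cylinder \<theta> (snd p))" if p: "p \<in> \<A>" for p
  proof -
    note s = cylinder_in_sets[OF fin[OF p]]
    have "malg_cond ?M (fst p) (cyl_class \<theta> (snd p)) > \<delta>" using p assms(4) by auto
    then show ?thesis
      using X[OF p] s unfolding malg_cond_def cyl_class_def X_class[OF p]
      by (simp add: malg_inf_class malg_measure_class measure_cylinder[OF fin[OF p]] field_simps)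
  qed
  define approximates where "approximates p q F S \<longleftrightarrow>
    \<delta> < of_rat q \<and> finite F \<and> dom (snd p) \<subseteq> F \<and> F \<subseteq> \<theta> \<and> S \<subseteq> {a. dom a = F \<and> snd p \<subseteq>\<^sub>m a} \<and>
    of_rat q / 2 ^ card (dom (snd p)) < measure ?M (\<Union>a\<in>S. cylinder \<theta> a) \<and>
    measure ?M (sym_diff (X p \<inter> cylinder \<theta> (snd p)) (\<Union>a\<in>S. cylinder \<theta> a))
      < ((of_rat q)\<^sup>2 - \<delta>\<^sup>2) / 4 ^ card (dom (snd p)) / 2" for p and q :: rat and F S
  have "\<exists>q F S. approximates p q F S" if p: "p \<in> \<A>" for p
    unfolding approximates_def
    by (rule exists_rational_approximation[OF X[OF p] fin[OF p] assms(1) gt[OF p]])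
  then obtain q F S where "\<And>p. p \<in> \<A> \<Longrightarrow> approximates p (q p) (F p) (S p)"
    by metis
  note qFS = this[unfolded approximates_def]
  have q: "\<delta> < of_rat (q p)" if "p \<in> \<A>" for p
    using qFS[OF that] by (elim conjE)
  have F: "finite (F p)" "F p \<subseteq> \<theta>" "dom (snd p) \<subseteq> F p"
    "S p \<subseteq> {a. dom a = F p \<and> snd p \<subseteq>\<^sub>m a}" if "p \<in> \<A>" for p
    using qFS[OF that] by - (elim conjE, assumption)+
  have big: "of_rat (q p) / 2 ^ card (dom (snd p)) < measure ?M (\<Union>a\<in>S p. cylinder \<theta> a)"
    if "p \<in> \<A>" for p
    using qFS[OF that] by (elim conjE)
  have approx: "measure ?M (sym_diff (X p \<inter> cylinder \<theta> (snd p)) (\<Union>a\<in>S p. cylinder \<theta> a))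
      < ((of_rat (q p))\<^sup>2 - \<delta>\<^sup>2) / 4 ^ card (dom (snd p)) / 2" if "p \<in> \<A>" for p
    using qFS[OF that] by (elim conjE)
  \<comment> \<open>First thinning: a common \<open>q\<close> gives one gap for all members, a
    common size of the conditions gives one scale \<open>4 ^ n\<close>, and a common size of the
    sets \<open>F p\<close> is what \<open>delta_system\<close> requires.\<close>
  have "countable ((\<lambda>p. (q p, card (dom (snd p)), card (F p))) ` \<A>)" by simp
  from uncountable_fibre[OF assms(3) this] obtain c
    where "uncountable {p\<in>\<A>. (q p, card (dom (snd p)), card (F p)) = c}" .
  then obtain q0 n m where A1: "uncountable {p\<in>\<A>. (q p, card (dom (snd p)), card (F p)) = (q0, n, m)}"
    by (cases c) simp
  let ?A1 = "{p\<in>\<A>. (q p, card (dom (snd p)), card (F p)) = (q0, n, m)}"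
  obtain \<B> R where B: "\<B> \<subseteq> ?A1" "uncountable \<B>" and R: "pairwise (\<lambda>a b. F a \<inter> F b = R) \<B>"
    using delta_system[OF A1, of F m] F(1) by auto
  \<comment> \<open>The Delta-system property speaks of distinct members only, so two of them are
    needed to see \<open>R\<close> as an intersection of finite sets.\<close>
  have "\<exists>a\<in>\<B>. \<exists>b\<in>\<B>. a \<noteq> b"
  proof (rule ccontr)
    assume "\<not> ?thesis"
    then have "\<B> = {} \<or> (\<exists>a. \<B> = {a})" by blast
    then show False using B(2) by auto
  qed
  then obtain a b where "a \<in> \<B>" "b \<in> \<B>" "a \<noteq> b" by blast
  then have "R = F a \<inter> F b" "a \<in> \<A>" using R B(1) by (auto simp: pairwise_def)
  then have finR: "finite R" using F(1) by simp
  \<comment> \<open>Last thinning. As the sizes of \<open>F p\<close> and \<open>R\<close> are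
    fixed, the count at \<open>r\<close> is, up to a constant factor, the conditional measure of the
    approximating set on the cylinder of \<open>r\<close>. The bounded lambda makes the count
    function extensional on a finite set, which leaves countably many possibilities.\<close>
  define f where "f p = (snd p |` R, \<lambda>r\<in>{r. dom r = R}. card {a\<in>S p. a |` R = r})" for p
  have "f ` \<B> \<subseteq> {s. dom s \<subseteq> R} \<times> PiE {r. dom r = R} (\<lambda>_. UNIV)"
  proof (rule image_subsetI)
    fix p
    show "f p \<in> {s. dom s \<subseteq> R} \<times> PiE {r. dom r = R} (\<lambda>_. UNIV)"
      unfolding f_def by (rule SigmaI) (simp, simp)
  qed
  moreover have "countable ({s :: 'i \<rightharpoonup> bool. dom s \<subseteq> R} \<times> PiE {r :: 'i \<rightharpoonup> bool. dom r = R} (\<lambda>_. UNIV :: nat set))"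
    using finite_maps_on[OF finR] finite_dom_eq[OF finR]
    by (intro countable_SIGMA countable_PiE) (auto intro: countable_finite)
  ultimately have "countable (f ` \<B>)" by (rule countable_subset)
  from uncountable_fibre[OF B(2) this] obtain c where C: "uncountable {p\<in>\<B>. f p = c}" .
  let ?C = "{p\<in>\<B>. f p = c}"
  have C_A: "p \<in> \<A>" "card (dom (snd p)) = n" "card (F p) = m" "q p = q0" if "p \<in> ?C" for p
    using that B(1) by auto
  have key: "0 < measure ?M (cylinder \<theta> (snd p) \<inter> cylinder \<theta> (snd p'))"
    "\<delta>\<^sup>2 * measure ?M (cylinder \<theta> (snd p) \<inter> cylinder \<theta> (snd p'))
      < measure ?M (X p \<inter> X p' \<inter> (cylinder \<theta> (snd p) \<inter> cylinder \<theta> (snd p')))"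
    if p: "p \<in> ?C" and p': "p' \<in> ?C" for p p'
  proof -
    note A = C_A[OF p] C_A[OF p']
    have ff: "f p = f p'" using p p' by simp
    then have root: "snd p |` R = snd p' |` R"
      and "(\<lambda>r\<in>{r. dom r = R}. card {a\<in>S p. a |` R = r}) = (\<lambda>r\<in>{r. dom r = R}. card {a\<in>S p'. a |` R = r})"
      unfolding f_def by simp_all
    then have same: "card {a\<in>S p. a |` R = r} = card {a\<in>S p'. a |` R = r}" if "dom r = R" for r
      using that by (metis (mono_tags, lifting) mem_Collect_eq restrict_apply')
    show "0 < measure ?M (cylinder \<theta> (snd p) \<inter> cylinder \<theta> (snd p'))"
    proof (cases "p = p'")
      case True
      then show ?thesis using measure_cylinder[OF fin[OF A(1)]] by simp
    next
      case False
      \<comment> \<open>All common coordinates of the two conditions lie in the root, where the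
        conditions agree; hence they are compatible.\<close>
      then have "F p \<inter> F p' = R" using R p p' by (auto simp: pairwise_def)
      then have "dom (snd p) \<inter> dom (snd p') \<subseteq> R" using F(3) A by blast
      then show ?thesis using measure_cylinder_Int[OF fin fin _ root] A by simp
    qed
    show "\<delta>\<^sup>2 * measure ?M (cylinder \<theta> (snd p) \<inter> cylinder \<theta> (snd p'))
      < measure ?M (X p \<inter> X p' \<inter> (cylinder \<theta> (snd p) \<inter> cylinder \<theta> (snd p')))"
    proof (cases "p = p'")
      case True
      \<comment> \<open>On the diagonal the Delta-system says nothing. Here a conditional
        probability exceeds \<delta>, so \<delta> is below 1 and its square is at most
        \<delta>.\<close>
      note gt[OF A(1)]
      also have "measure ?M (X p \<inter> cylinder \<theta> (snd p)) \<le> measure ?M (cylinder \<theta> (snd p))"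
        using cylinder_in_sets[OF fin[OF A(1)]] by (intro finite_measure_mono) auto
      finally have "\<delta> < 1" using measure_cylinder[OF fin[OF A(1)]] by (simp add: field_simps)
      then have "\<delta>\<^sup>2 \<le> \<delta>" using assms(1) by (simp add: power2_eq_square mult_left_le)
      then have "\<delta>\<^sup>2 / 2 ^ card (dom (snd p)) \<le> \<delta> / 2 ^ card (dom (snd p))"
        by (rule divide_right_mono) simp
      with gt[OF A(1)] True show ?thesis using measure_cylinder[OF fin[OF A(1)]] by simp
    next
      case False
      then have R': "F p \<inter> F p' = R" using R p p' by (auto simp: pairwise_def)
      have *: "0 \<le> real_of_rat q0" using q[OF A(1)] assms(1) unfolding A(4) by linarith
      show ?thesis
      proof (rule measure_Int_gt_of_approximation
          [OF X[OF A(1)] X[OF A(5)] fin[OF A(1)] fin[OF A(5)] A(2) A(6)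
            F(1)[OF A(1)] F(2)[OF A(1)] F(3)[OF A(1)] F(4)[OF A(1)]
            F(1)[OF A(5)] F(2)[OF A(5)] F(3)[OF A(5)] F(4)[OF A(5)] _ _ _ *])
        show "card (F p) = card (F p')" using A by simp
        show "snd p |` (F p \<inter> F p') = snd p' |` (F p \<inter> F p')" unfolding R' by (rule root)
        show "card {a\<in>S p. a |` (F p \<inter> F p') = r} = card {b\<in>S p'. b |` (F p \<inter> F p') = r}"
          if "dom r = F p \<inter> F p'" for r
          using that unfolding R' by (rule same)
      qed (use big[OF A(1)] approx[OF A(1)] approx[OF A(5)] A in simp_all)
    qed
  qed
  have pair: "malg_inf ?M (cyl_class \<theta> (snd p)) (cyl_class \<theta> (snd p')) \<noteq> malg_zero ?M \<and>
    \<delta>\<^sup>2 < malg_cond ?M (malg_inf ?M (fst p) (fst p'))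
      (malg_inf ?M (cyl_class \<theta> (snd p)) (cyl_class \<theta> (snd p')))"
    if p: "p \<in> ?C" and p': "p' \<in> ?C" for p p'
  proof -
    note A = C_A(1)[OF p] C_A(1)[OF p']
    let ?st = "cylinder \<theta> (snd p) \<inter> cylinder \<theta> (snd p')"
    have sets: "cylinder \<theta> (snd p) \<in> sets ?M" "cylinder \<theta> (snd p') \<in> sets ?M"
      using cylinder_in_sets[OF fin[OF A(1)]] cylinder_in_sets[OF fin[OF A(2)]] .
    then have st: "?st \<in> sets ?M" and XX: "X p \<inter> X p' \<in> sets ?M" using X A by auto
    have inf: "malg_inf ?M (cyl_class \<theta> (snd p)) (cyl_class \<theta> (snd p')) = malg_class ?M ?st"
      "malg_inf ?M (fst p) (fst p') = malg_class ?M (X p \<inter> X p')"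
      unfolding cyl_class_def X_class[OF A(1)] X_class[OF A(2)]
      using malg_inf_class[OF sets] malg_inf_class[OF X[OF A(1)] X[OF A(2)]] .
    have "malg_class ?M ?st \<noteq> malg_zero ?M"
    proof
      assume "malg_class ?M ?st = malg_zero ?M"
      then have "malg_measure ?M (malg_class ?M ?st) = malg_measure ?M (malg_class ?M {})"
        by (simp add: malg_zero_def)
      then show False using key(1)[OF p p'] by (simp add: malg_measure_class[OF st] malg_measure_class)
    qed
    moreover have "\<delta>\<^sup>2 < measure ?M (X p \<inter> X p' \<inter> ?st) / measure ?M ?st"
      using key[OF p p'] by (simp add: field_simps)
    ultimately show ?thesis
      unfolding inf malg_cond_def malg_inf_class[OF XX st]
      using malg_measure_class[OF st] malg_measure_class[OF sets.Int[OF XX st]] by simp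
  qed
  have "?C \<subseteq> \<A>" using C_A(1) by blast
  with C show ?thesis
    unfolding case_prod_beta
    by (intro exI[of _ ?C] conjI ballI) (assumption | rule pair[THEN conjunct1] pair[THEN conjunct2])+
qed

end
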